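(* Let $m\ge1$, let $(A,B,c)$ be a triplet over $\mathbb{C}$ with associated polynomial $p$, let $k\in\{1,\dots,m\}$ and $\alpha\in\mathbb{C}\setminus\{0\}$. Let $(\hat A,\hat B,\hat c)$ be the triplet obtained from $(A,B,c)$ by setting $$\hat a_{k,j}=\alpha a_{k,j}\quad (j=1,\dots,k+1),$$ $$\hat a_{i,k+2}=\alpha^{-1}a_{i,k+2},\qquad \hat b_{i,k+2}=\alpha^{-1}b_{i,k+2}\quad (i=k+1,\dots,m),$$ $$\hat c_{k+2}=\alpha^{-1}c_{k+2},$$ with all other entries of $\hat A,\hat B,\hat c$ equal to the corresponding entries of $A,B,c$. Then the polynomial $\hat p$ associated with $(\hat A,\hat B,\hat c)$ satisfies $\hat p=p$.
   Context: Evaluation scheme. A triplet $(A,B,c)$ (for $m$ multiplications) consists of scalars $a_{i,j},b_{i,j}\in\mathbb{C}$ for $1\le i\le m$, $1\le j\le i+1$ (the entries of $m\times(m+1)$ lower Hessenberg matrices $A,B$; entries with $j>i+1$ are zero), and a vector $c=(c_1,\dots,c_{m+2})\in\mathbb{C}^{m+2}$. The associated polynomial is $p=\sum_{j=1}^{m+2}c_jQ_j\in\mathbb{C}[x]$, where $Q_1=1$, $Q_2=x$, and for $i=1,\dots,m$ $$Q_{i+2}=\Big(\sum_{j=1}^{i+1}a_{i,j}Q_j\Big)\Big(\sum_{j=1}^{i+1}b_{i,j}Q_j\Big).$$ *)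

theory Defs
  imports Complex_Main "HOL-Computational_Algebra.Polynomial"
begin

text \<open>
  The entries \<open>a i j\<close>, \<open>b i j\<close> and \<open>c j\<close> are indexed from 1. A triplet for \<open>m\<close> multiplications
  is represented by total functions that are zero outside the index range; in particular
  the entries with \<open>j > i + 1\<close> are zero (lower Hessenberg form).
\<close>

definition hessenberg_entries :: "nat \<Rightarrow> (nat \<Rightarrow> nat \<Rightarrow> complex) \<Rightarrow> bool" where
  "hessenberg_entries m a \<longleftrightarrow>
     (\<forall>i j. \<not> (1 \<le> i \<and> i \<le> m \<and> 1 \<le> j \<and> j \<le> i + 1) \<longrightarrow> a i j = 0)"

definition is_triplet ::
  "nat \<Rightarrow> (nat \<Rightarrow> nat \<Rightarrow> complex) \<Rightarrow> (nat \<Rightarrow> nat \<Rightarrow> complex) \<Rightarrow> (nat \<Rightarrow> complex) \<Rightarrow> bool" where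
  "is_triplet m a b c \<longleftrightarrow>
     hessenberg_entries m a \<and> hessenberg_entries m b \<and>
     (\<forall>j. \<not> (1 \<le> j \<and> j \<le> m + 2) \<longrightarrow> c j = 0)"

text \<open>The value at index 0 is junk and is never used.\<close>

function scheme_Q ::
  "(nat \<Rightarrow> nat \<Rightarrow> complex) \<Rightarrow> (nat \<Rightarrow> nat \<Rightarrow> complex) \<Rightarrow> nat \<Rightarrow> complex poly" where
  "scheme_Q a b 0 = 0"
| "scheme_Q a b (Suc 0) = 1"
| "scheme_Q a b (Suc (Suc 0)) = [:0, 1:]"
| "scheme_Q a b (Suc (Suc (Suc n))) =
     (\<Sum>j = 1..n + 2. smult (a (n + 1) j) (scheme_Q a b j)) *
     (\<Sum>j = 1..n + 2. smult (b (n + 1) j) (scheme_Q a b j))"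
  by pat_completeness auto
termination
  by (relation "measure (\<lambda>(a, b, n). n)") auto

lemma scheme_Q_rec:
  assumes "i \<ge> 1"
  shows "scheme_Q a b (i + 2) =
     (\<Sum>j = 1..i + 1. smult (a i j) (scheme_Q a b j)) *
     (\<Sum>j = 1..i + 1. smult (b i j) (scheme_Q a b j))"
proof -
  obtain n where "i = Suc n"
    using assms by (cases i) auto
  then show ?thesis
    by simp
qed

definition scheme_poly ::
  "nat \<Rightarrow> (nat \<Rightarrow> nat \<Rightarrow> complex) \<Rightarrow> (nat \<Rightarrow> nat \<Rightarrow> complex) \<Rightarrow> (nat \<Rightarrow> complex) \<Rightarrow> complex poly" where
  "scheme_poly m a b c = (\<Sum>j = 1..m + 2. smult (c j) (scheme_Q a b j))"

definition rescale_a ::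
  "nat \<Rightarrow> nat \<Rightarrow> complex \<Rightarrow> (nat \<Rightarrow> nat \<Rightarrow> complex) \<Rightarrow> nat \<Rightarrow> nat \<Rightarrow> complex" where
  "rescale_a m k \<alpha> a i j =
     (if i = k \<and> 1 \<le> j \<and> j \<le> k + 1 then \<alpha> * a i j
      else if k + 1 \<le> i \<and> i \<le> m \<and> j = k + 2 then inverse \<alpha> * a i j
      else a i j)"

definition rescale_b ::
  "nat \<Rightarrow> nat \<Rightarrow> complex \<Rightarrow> (nat \<Rightarrow> nat \<Rightarrow> complex) \<Rightarrow> nat \<Rightarrow> nat \<Rightarrow> complex" where
  "rescale_b m k \<alpha> b i j =
     (if k + 1 \<le> i \<and> i \<le> m \<and> j = k + 2 then inverse \<alpha> * b i j else b i j)"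

definition rescale_c :: "nat \<Rightarrow> complex \<Rightarrow> (nat \<Rightarrow> complex) \<Rightarrow> nat \<Rightarrow> complex" where
  "rescale_c k \<alpha> c j = (if j = k + 2 then inverse \<alpha> * c j else c j)"

lemma is_triplet_rescale:
  assumes "is_triplet m a b c"
  shows "is_triplet m (rescale_a m k \<alpha> a) (rescale_b m k \<alpha> b) (rescale_c k \<alpha> c)"
  using assms
  by (simp add: is_triplet_def hessenberg_entries_def rescale_a_def rescale_b_def rescale_c_def)

end

theory Submission
  imports Defs
begin

text \<open>Rescaling multiplies \<open>Q\<^sub>k\<^sub>+\<^sub>2\<close> by \<open>\<alpha>\<close> and fixes every other \<open>Q\<^sub>j\<close>:
  the inverse factors in column \<open>k + 2\<close> cancel the \<open>\<alpha>\<close> wherever \<open>Q\<^sub>k\<^sub>+\<^sub>2\<close> is used.\<close>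

lemma smult_sum_right:
  "smult c (\<Sum>x\<in>A. f x) = (\<Sum>x\<in>A. smult c (f x))"
  by (induction A rule: infinite_finite_induct) (simp_all add: smult_add_right)

text \<open>Strong induction, since \<open>scheme_Q\<close> refers to all earlier indices. The bound
  on \<open>n\<close> keeps every row in use at most \<open>m\<close>, where column
  \<open>k + 2\<close> is divided by \<alpha>.\<close>

lemma scheme_Q_rescale:
  assumes "k \<ge> 1" and "\<alpha> \<noteq> 0" and "n \<le> m + 2"
  shows "scheme_Q (rescale_a m k \<alpha> a) (rescale_b m k \<alpha> b) n =
         smult (if n = k + 2 then \<alpha> else 1) (scheme_Q a b n)"
  using assms(3)
proof (induction n rule: less_induct)
  case (less n)
  let ?Q' = "scheme_Q (rescale_a m k \<alpha> a) (rescale_b m k \<alpha> b)"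
  show ?case
  proof (cases "n \<le> 2")
    case True
    then consider "n = 0" | "n = Suc 0" | "n = Suc (Suc 0)"
      by linarith
    \<comment> \<open>As \<open>k \<ge> 1\<close>, the special index \<open>k + 2\<close> is at
      least 3.\<close>
    then show ?thesis
      using assms(1) by cases auto
  next
    case False
    define i where "i = n - 2"
    have i: "n = i + 2" "1 \<le> i" "i \<le> m"
      using False less.prems by (auto simp: i_def)
    have IH: "?Q' j = smult (if j = k + 2 then \<alpha> else 1) (scheme_Q a b j)"
      if "j \<in> {1..i + 1}" for j
      using less.IH[of j] less.prems that i by auto
    \<comment> \<open>Row \<open>k\<close> stops at column \<open>k + 1\<close>, so only its own
      factor \<alpha> appears; column \<open>k + 2\<close> is reached only in rows
      \<open>i > k\<close>, where the factors cancel.\<close>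
    have row_a: "(\<Sum>j = 1..i + 1. smult (rescale_a m k \<alpha> a i j) (?Q' j)) =
        smult (if i = k then \<alpha> else 1) (\<Sum>j = 1..i + 1. smult (a i j) (scheme_Q a b j))"
      unfolding smult_sum_right
      by (rule sum.cong) (use i assms(2) in \<open>auto simp: IH rescale_a_def field_simps\<close>)
    \<comment> \<open>Row \<open>k\<close> of \<open>b\<close> is left alone, so the product gains
      \<alpha> just once.\<close>
    have row_b: "(\<Sum>j = 1..i + 1. smult (rescale_b m k \<alpha> b i j) (?Q' j)) =
        (\<Sum>j = 1..i + 1. smult (b i j) (scheme_Q a b j))"
      by (rule sum.cong) (use i assms(2) in \<open>auto simp: IH rescale_b_def field_simps\<close>)
    show ?thesis
      unfolding i(1) scheme_Q_rec[OF i(2)] row_a row_b by simp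
  qed
qed

theorem theorem3p1:
  fixes m k :: nat
    and a b :: "nat \<Rightarrow> nat \<Rightarrow> complex"
    and c :: "nat \<Rightarrow> complex"
    and \<alpha> :: complex
  assumes "m \<ge> 1"
    and "is_triplet m a b c"
    and "k \<in> {1..m}"
    and "\<alpha> \<noteq> 0"
  shows "scheme_poly m (rescale_a m k \<alpha> a) (rescale_b m k \<alpha> b) (rescale_c k \<alpha> c) =
         scheme_poly m a b c"
  unfolding scheme_poly_def
  \<comment> \<open>At \<open>j = k + 2\<close> the inverse in \<open>rescale_c\<close> cancels
    \<alpha>.\<close>
  by (rule sum.cong) (use assms(3,4) in \<open>auto simp: scheme_Q_rescale rescale_c_def field_simps\<close>)

end
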